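(* Let $(f,x_0)$ be a $(\mathcal C_M,R_x)$-input for some real $M,R_x\ge0$. For any sequence $\{x_i\}$ generated by the SSEP-based subgradient method with an exact line search given $f$ and $x_0$, $$f(x_N)-f_*\le\frac{MR_x}{\sqrt{N+1}},\qquad\forall N\in\mathbb N.$$
   Context: $\langle\cdot,\cdot\rangle$, $\|\cdot\|$ are the Euclidean inner product and norm on $\mathbb R^d$; $\mathbb N$ denotes the positive integers; $f_*:=\min f$. $\mathcal C_M=\mathcal C_M(\mathbb R^d)$ is the class of (Lipschitz) closed, convex and proper functions $f$ on $\mathbb R^d$ such that $\|g\|\le M$ for all $x\in\mathbb R^d$ and all $g\in\partial f(x)$. $(f,x_0)$ is a $(\mathcal C_M,R_x)$-input if $f\in\mathcal C_M(\mathbb R^d)$, $x_0\in\mathbb R^d$ and $\|x_0-x_*\|\le R_x$ for some $x_*\in\operatorname{argmin}f$. SSEP-based subgradient method with an exact line search (input $f,x_0$): pick any $f'(x_0)\in\partial f(x_0)$; for $i=1,2,\dots$ set $$y_i=\frac{i}{i+1}x_{i-1}+\frac1{i+1}x_0,\qquad d_i=\frac1{i+1}\sum_{j=0}^{i-1}f'(x_j),$$ $$\alpha\in\operatorname*{argmin}_{\alpha\in\mathbb R}f(y_i-\alpha d_i),\qquad x_i=y_i-\alpha d_i,$$ and choose $f'(x_i)\in\partial f(x_i)$ such that $\langle f'(x_i),d_i\rangle=0$. A generated sequence is any sequence satisfying these rules (in particular the line-search minima are attained). *)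

theory Defs
  imports "HOL-Analysis.Analysis"
begin

text \<open>Convex functions may take the value \<open>\<infinity>\<close>, so they are modelled as functions into
  \<^typ>\<open>ereal\<close>. The library's \<^const>\<open>epigraph\<close> and \<^const>\<open>convex_on\<close> only cover real-valued
  functions; closedness and convexity are therefore defined through the epigraph below,
  a subset of \<open>'a \<times> real\<close>.\<close>

definition ereal_epigraph :: "('a \<Rightarrow> ereal) \<Rightarrow> ('a \<times> real) set" where
  "ereal_epigraph f = {(x, t). f x \<le> ereal t}"

definition closed_fun :: "('a::topological_space \<Rightarrow> ereal) \<Rightarrow> bool" where
  "closed_fun f \<longleftrightarrow> closed (ereal_epigraph f)"

definition convex_fun :: "('a::real_vector \<Rightarrow> ereal) \<Rightarrow> bool" where
  "convex_fun f \<longleftrightarrow> convex (ereal_epigraph f)"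

definition proper_fun :: "('a \<Rightarrow> ereal) \<Rightarrow> bool" where
  "proper_fun f \<longleftrightarrow> (\<forall>x. f x \<noteq> -\<infinity>) \<and> (\<exists>x. f x \<noteq> \<infinity>)"

text \<open>For proper \<open>f\<close> this is empty wherever \<open>f x = \<infinity>\<close>, as usual.\<close>

definition subdifferential :: "('a::real_inner \<Rightarrow> ereal) \<Rightarrow> 'a \<Rightarrow> 'a set" where
  "subdifferential f x = {g. \<forall>y. f x + ereal (g \<bullet> (y - x)) \<le> f y}"

text \<open>Lipschitz continuity is not a separate requirement: it follows from the bound on the
  subgradients.\<close>

definition C_class :: "real \<Rightarrow> ('a::euclidean_space \<Rightarrow> ereal) set" where
  "C_class M = {f. closed_fun f \<and> convex_fun f \<and> proper_fun f \<and>
                   (\<forall>x. \<forall>g \<in> subdifferential f x. norm g \<le> M)}"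

definition argmin_set :: "('a \<Rightarrow> 'b::order) \<Rightarrow> 'a set" where
  "argmin_set f = {x. is_arg_min f (\<lambda>_. True) x}"

text \<open>The infimum is a minimum whenever \<open>argmin_set f\<close> is nonempty.\<close>

definition min_value :: "('a \<Rightarrow> ereal) \<Rightarrow> ereal" where
  "min_value f = (INF x. f x)"

definition is_input :: "real \<Rightarrow> real \<Rightarrow> ('a::euclidean_space \<Rightarrow> ereal) \<Rightarrow> 'a \<Rightarrow> bool" where
  "is_input M R f x0 \<longleftrightarrow> f \<in> C_class M \<and> (\<exists>xs \<in> argmin_set f. norm (x0 - xs) \<le> R)"

text \<open>\<open>g i\<close> is the subgradient \<open>f'(x\<^sub>i)\<close> chosen at iteration \<open>i\<close>; it is a choice attached to the
  index, so equal iterates may carry different subgradients.\<close>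

definition ssep_exact_line_search ::
  "('a::euclidean_space \<Rightarrow> ereal) \<Rightarrow> 'a \<Rightarrow> (nat \<Rightarrow> 'a) \<Rightarrow> bool" where
  "ssep_exact_line_search f x0 x \<longleftrightarrow>
     (\<exists>g y d :: nat \<Rightarrow> 'a. \<exists>\<alpha> :: nat \<Rightarrow> real.
        x 0 = x0 \<and> g 0 \<in> subdifferential f x0 \<and>
        (\<forall>i\<ge>1.
           y i = (real i / (real i + 1)) *\<^sub>R x (i - 1) + (1 / (real i + 1)) *\<^sub>R x0 \<and>
           d i = (1 / (real i + 1)) *\<^sub>R (\<Sum>j=0..i - 1. g j) \<and>
           \<alpha> i \<in> argmin_set (\<lambda>a. f (y i - a *\<^sub>R d i)) \<and>
           x i = y i - \<alpha> i *\<^sub>R d i \<and>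
           g i \<in> subdifferential f (x i) \<and>
           g i \<bullet> d i = 0))"

end

theory Submission
  imports Defs
begin

text \<open>The proof is a telescoping argument. Let \<open>F\<^sub>i = f (x\<^sub>i)\<close>, let \<open>g\<^sub>i\<close> be the chosen subgradients,
  \<open>S\<^sub>i = g\<^sub>0 + \<dots> + g\<^sub>i\<close>, and let \<open>z\<close> be a minimiser. Orthogonality of \<open>g\<^sub>i\<close> to \<open>d\<^sub>i\<close>, a multiple of
  \<open>S\<^sub>i\<^sub>-\<^sub>1\<close>, is used twice.

  Since \<open>x\<^sub>i - y\<^sub>i\<close> is a multiple of \<open>d\<^sub>i\<close>, the subgradient \<open>g\<^sub>i\<close> is orthogonal to
  \<open>(i + 1) (x\<^sub>i - y\<^sub>i) = i (x\<^sub>i - x\<^sub>i\<^sub>-\<^sub>1) + (x\<^sub>i - x\<^sub>0)\<close>. So adding \<open>i\<close> times the subgradient inequality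
  from \<open>x\<^sub>i\<close> to \<open>x\<^sub>i\<^sub>-\<^sub>1\<close> to the one from \<open>x\<^sub>i\<close> to \<open>z\<close> eliminates both iterates and leaves
  \<open>(i + 1) (F\<^sub>i - F\<^sub>*) \<le> i (F\<^sub>i\<^sub>-\<^sub>1 - F\<^sub>*) + g\<^sub>i \<bullet> (x\<^sub>0 - z)\<close>. These inequalities telescope to
  \<open>(N + 1) (F\<^sub>N - F\<^sub>*) \<le> S\<^sub>N \<bullet> (x\<^sub>0 - z)\<close> (\<open>ssep_gap_le_inner_subgradient_sum\<close>).

  Also, \<open>g\<^sub>i\<close> is orthogonal to \<open>S\<^sub>i\<^sub>-\<^sub>1\<close>, so the Pythagorean theorem gives
  \<open>\<parallel>S\<^sub>N\<parallel> \<le> M \<surd>(N + 1)\<close> instead of the \<open>M (N + 1)\<close> of the triangle inequality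
  (\<open>norm_sum_le_of_successive_orthogonal\<close>). Cauchy-Schwarz combines the two bounds.\<close>

text \<open>Comparison with a point of finite value shows that all iterates lie in the effective domain of
  \<open>f\<close>, so the argument can be carried out in the reals.\<close>

lemma subdifferential_finite:
  assumes "proper_fun f" "g \<in> subdifferential f x"
  shows "\<bar>f x\<bar> \<noteq> \<infinity>"
proof -
  obtain y where y: "f y \<noteq> \<infinity>"
    using assms(1) unfolding proper_fun_def by blast
  have "f x + ereal (g \<bullet> (y - x)) \<le> f y"
    using assms(2) unfolding subdifferential_def by blast
  then have "f x \<noteq> \<infinity>"
    using y by auto
  moreover have "f x \<noteq> -\<infinity>"
    using assms(1) unfolding proper_fun_def by blast
  ultimately show ?thesis by auto
qed

lemma subgradient_inequality_real:
  assumes "g \<in> subdifferential f x" "f x = ereal a" "f y = ereal b"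
  shows "a + g \<bullet> (y - x) \<le> b"
proof -
  have "f x + ereal (g \<bullet> (y - x)) \<le> f y"
    using assms(1) unfolding subdifferential_def by blast
  then show ?thesis
    using assms(2,3) by simp
qed

lemma min_value_eq:
  assumes "z \<in> argmin_set f"
  shows "min_value f = f z"
proof -
  have "f z \<le> f y" for y
    using assms unfolding argmin_set_def is_arg_min_def by (simp add: not_less)
  then show ?thesis
    unfolding min_value_def by (intro antisym INF_lower INF_greatest) auto
qed

text \<open>By the Pythagorean theorem each new term adds at most \<open>M\<^sup>2\<close> to the squared norm of the sum.\<close>

lemma norm_sum_le_of_successive_orthogonal:
  fixes g :: "nat \<Rightarrow> 'a::real_inner"
  assumes "\<And>i. norm (g i) \<le> M"
    and "\<And>i. g (Suc i) \<bullet> (\<Sum>j\<le>i. g j) = 0"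
  shows "norm (\<Sum>j\<le>n. g j) \<le> M * sqrt (real n + 1)"
proof -
  have "M \<ge> 0"
    using assms(1)[of 0] norm_ge_zero order_trans by blast
  have sq: "(norm (g i))\<^sup>2 \<le> M\<^sup>2" for i
    using assms(1) by (simp add: power_mono)
  have "(norm (\<Sum>j\<le>n. g j))\<^sup>2 \<le> M\<^sup>2 * (real n + 1)"
  proof (induction n)
    case 0
    show ?case using sq by simp
  next
    case (Suc n)
    have "(norm (\<Sum>j\<le>Suc n. g j))\<^sup>2 = (norm (\<Sum>j\<le>n. g j))\<^sup>2 + (norm (g (Suc n)))\<^sup>2"
      using assms(2)[of n] by (simp add: power2_norm_eq_inner inner_add inner_commute)
    also have "\<dots> \<le> M\<^sup>2 * (real n + 1) + M\<^sup>2"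
      using Suc sq by (intro add_mono)
    finally show ?case by (simp add: algebra_simps)
  qed
  then have "(norm (\<Sum>j\<le>n. g j))\<^sup>2 \<le> (M * sqrt (real n + 1))\<^sup>2"
    by (simp add: power_mult_distrib)
  then show ?thesis
    by (rule power2_le_imp_le) (simp add: \<open>M \<ge> 0\<close>)
qed

text \<open>The weights \<open>n + 1\<close> and \<open>1\<close> on the two subgradient inequalities are dictated by \<open>orth\<close>, which
  says that \<open>g\<^sub>n\<^sub>+\<^sub>1\<close> is orthogonal to \<open>(n + 2) (x\<^sub>n\<^sub>+\<^sub>1 - y\<^sub>n\<^sub>+\<^sub>1)\<close>: with them the dependence on the
  iterates cancels, and the scaled gap \<open>(n + 1) (F\<^sub>n - F\<^sub>*)\<close> grows by at most
  \<open>g\<^sub>n\<^sub>+\<^sub>1 \<bullet> (x\<^sub>0 - z)\<close>.\<close>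

lemma ssep_gap_le_inner_subgradient_sum:
  fixes x g :: "nat \<Rightarrow> 'a::real_inner" and F :: "nat \<Rightarrow> real"
  assumes comparison: "\<And>i. F i + g i \<bullet> (z - x i) \<le> Fz"
    and step: "\<And>i. F (Suc i) + g (Suc i) \<bullet> (x i - x (Suc i)) \<le> F i"
    and orth: "\<And>i. g (Suc i) \<bullet> (real (Suc i) *\<^sub>R (x (Suc i) - x i) + (x (Suc i) - x 0)) = 0"
  shows "(real n + 1) * (F n - Fz) \<le> (\<Sum>j\<le>n. g j) \<bullet> (x 0 - z)"
proof (induction n)
  case 0
  show ?case using comparison[of 0] by (simp add: inner_diff_right)
next
  case (Suc n)
  let ?g = "g (Suc n)"
  have "(real n + 1) * (F (Suc n) + ?g \<bullet> (x n - x (Suc n))) \<le> (real n + 1) * F n"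
    using step[of n] by (intro mult_left_mono) auto
  then have "(real n + 2) * (F (Suc n) - Fz) \<le> (real n + 1) * (F n - Fz) + ?g \<bullet> (x 0 - z)"
    using comparison[of "Suc n"] orth[of n]
    by (simp add: inner_diff_right inner_add_right algebra_simps)
  then show ?case
    using Suc by (simp add: inner_add_left algebra_simps)
qed

theorem corollary4:
  fixes f :: "real ^ 'd \<Rightarrow> ereal" and x0 :: "real ^ 'd" and x :: "nat \<Rightarrow> real ^ 'd"
    and M R :: real
  assumes "M \<ge> 0" and "R \<ge> 0"
    and "is_input M R f x0"
    and "ssep_exact_line_search f x0 x"
  shows "\<forall>N::nat. N \<ge> 1 \<longrightarrow> f (x N) - min_value f \<le> ereal (M * R / sqrt (real N + 1))"
proof (intro allI impI)
  fix N :: nat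
  obtain z where z: "z \<in> argmin_set f" and R: "norm (x0 - z) \<le> R"
    using assms(3) unfolding is_input_def by blast
  have proper: "proper_fun f" and bound: "\<And>x g. g \<in> subdifferential f x \<Longrightarrow> norm g \<le> M"
    using assms(3) unfolding is_input_def C_class_def by auto
  obtain g y d \<alpha> where x_0: "x 0 = x0" and g_0: "g 0 \<in> subdifferential f x0"
    and rules: "\<And>i. i \<ge> 1 \<Longrightarrow>
      y i = (real i / (real i + 1)) *\<^sub>R x (i - 1) + (1 / (real i + 1)) *\<^sub>R x0 \<and>
      d i = (1 / (real i + 1)) *\<^sub>R (\<Sum>j=0..i - 1. g j) \<and>
      x i = y i - \<alpha> i *\<^sub>R d i \<and> g i \<in> subdifferential f (x i) \<and> g i \<bullet> d i = 0"
    using assms(4) unfolding ssep_exact_line_search_def by blast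
  have sub: "g i \<in> subdifferential f (x i)" for i
    using x_0 g_0 rules[of i] by (cases "i = 0") auto
  define F where "F i = real_of_ereal (f (x i))" for i
  have F: "f (x i) = ereal (F i)" for i
    using subdifferential_finite[OF proper sub, of i] unfolding F_def by (simp add: ereal_real)
  have "f z \<le> f (x 0)"
    using z unfolding argmin_set_def is_arg_min_def by (simp add: not_less)
  moreover have "f z \<noteq> -\<infinity>"
    using proper unfolding proper_fun_def by blast
  ultimately obtain Fz where Fz: "f z = ereal Fz"
    using F[of 0] by (cases "f z") auto

  have nz: "real (Suc i) + 1 \<noteq> 0" for i
    by linarith
  have y: "y (Suc i) = (real (Suc i) / (real (Suc i) + 1)) *\<^sub>R x i + (1 / (real (Suc i) + 1)) *\<^sub>R x 0"
    and d: "d (Suc i) = (1 / (real (Suc i) + 1)) *\<^sub>R (\<Sum>j\<le>i. g j)"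
    and x_Suc: "x (Suc i) = y (Suc i) - \<alpha> (Suc i) *\<^sub>R d (Suc i)"
    and g_d: "g (Suc i) \<bullet> d (Suc i) = 0" for i
    using rules[of "Suc i", unfolded diff_Suc_1, OF le_add1[of 1 i, unfolded plus_1_eq_Suc]]
    unfolding x_0 atMost_atLeast0 by blast+
  have orth_sum: "g (Suc i) \<bullet> (\<Sum>j\<le>i. g j) = 0" for i
    using g_d[of i] nz[of i] unfolding d by (simp del: of_nat_Suc)
  have orth: "g (Suc i) \<bullet> (real (Suc i) *\<^sub>R (x (Suc i) - x i) + (x (Suc i) - x 0)) = 0" for i
  proof -
    let ?c = "real (Suc i) + 1"
    have c: "?c *\<^sub>R y (Suc i) = real (Suc i) *\<^sub>R x i + x 0"
      unfolding y using nz[of i] by (simp add: scaleR_add_right del: of_nat_Suc)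
    have "real (Suc i) *\<^sub>R (x (Suc i) - x i) + (x (Suc i) - x 0)
        = ?c *\<^sub>R x (Suc i) - (real (Suc i) *\<^sub>R x i + x 0)"
      by (simp add: scaleR_add_left scaleR_diff_right del: of_nat_Suc)
    also have "\<dots> = ?c *\<^sub>R (x (Suc i) - y (Suc i))"
      unfolding c[symmetric] by (simp add: scaleR_diff_right)
    also have "\<dots> = - (?c * \<alpha> (Suc i)) *\<^sub>R d (Suc i)"
      unfolding x_Suc by simp
    finally show ?thesis
      using g_d by simp
  qed

  have "(real N + 1) * (F N - Fz) \<le> (\<Sum>j\<le>N. g j) \<bullet> (x 0 - z)"
    using subgradient_inequality_real[OF sub F Fz] subgradient_inequality_real[OF sub F F] orth
    by (rule ssep_gap_le_inner_subgradient_sum)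
  also have "\<dots> \<le> norm (\<Sum>j\<le>N. g j) * norm (x 0 - z)"
    by (rule norm_cauchy_schwarz)
  also have "\<dots> \<le> (M * sqrt (real N + 1)) * R"
    using norm_sum_le_of_successive_orthogonal[of g M N] bound[OF sub] orth_sum R x_0 assms(1)
    by (intro mult_mono) auto
  finally have "F N - Fz \<le> M * sqrt (real N + 1) * R / (real N + 1)"
    by (simp add: pos_le_divide_eq mult.commute)
  also have "\<dots> = M * R / sqrt (real N + 1)"
  proof -
    have "M * s * R / (s * s) = M * R / s" if "s > 0" for s :: real
      using that by simp
    from this[of "sqrt (real N + 1)"] show ?thesis
      by simp
  qed
  finally show "f (x N) - min_value f \<le> ereal (M * R / sqrt (real N + 1))"
    using F Fz min_value_eq[OF z] by simp
qed

end
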